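(* Let $G$ be a graph such that every induced subgraph $H$ of $G$ (including $G$ itself) satisfies \[\chi(H) \leq \max\left\{\left\lceil \frac{7}{6}\omega(H) \right\rceil, \left\lceil \frac{\omega(H) + \Delta(H) + 1}{2}\right\rceil\right\}.\] Then \[\chi(G) \leq \left\lceil \frac{\omega(G) + \Delta(G) + 1}{2}\right\rceil.\]
   Context: Graphs are finite, simple and undirected. $\chi(G)$ denotes the chromatic number of $G$, $\omega(G)$ the clique number (the number of vertices in a largest clique), and $\Delta(G)$ the maximum degree. *)

theory Defs
  imports Complex_Main "Graph_Theory.Digraph_Component"
begin

text \<open>
  Finite simple undirected graphs are modelled by the locale \<open>graph\<close> of
  \<open>Graph_Theory\<close>: finite symmetric digraphs without loops and parallel arcs, so that
  an undirected edge is a pair of opposite arcs.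
\<close>

definition clique_in :: "('a, 'b) pre_digraph \<Rightarrow> 'a set \<Rightarrow> bool" where
  "clique_in G K \<longleftrightarrow> K \<subseteq> verts G \<and> (\<forall>u\<in>K. \<forall>v\<in>K. u \<noteq> v \<longrightarrow> u \<rightarrow>\<^bsub>G\<^esub> v)"

definition clique_number :: "('a, 'b) pre_digraph \<Rightarrow> nat" where
  "clique_number G = Max (card ` {K. clique_in G K})"

definition proper_coloring :: "('a, 'b) pre_digraph \<Rightarrow> nat \<Rightarrow> ('a \<Rightarrow> nat) \<Rightarrow> bool" where
  "proper_coloring G k c \<longleftrightarrow>
     (\<forall>v\<in>verts G. c v < k) \<and> (\<forall>u v. u \<rightarrow>\<^bsub>G\<^esub> v \<longrightarrow> c u \<noteq> c v)"

definition chromatic_number :: "('a, 'b) pre_digraph \<Rightarrow> nat" where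
  "chromatic_number G = (LEAST k. \<exists>c. proper_coloring G k c)"

text \<open>
  In a symmetric digraph without parallel arcs, the out-degree of a vertex is its degree
  in the undirected graph (lemma \<open>out_degree_eq_card_neighbours\<close> below).  Inserting 0
  only matters for the graph without vertices, whose maximum degree is taken to be 0.
\<close>

definition max_degree :: "('a, 'b) pre_digraph \<Rightarrow> nat" where
  "max_degree G = Max (insert 0 (out_degree G ` verts G))"

lemma (in nomulti_digraph) out_degree_eq_card_neighbours:
  "out_degree G v = card {w. v \<rightarrow>\<^bsub>G\<^esub> w}"
proof -
  have "{w. v \<rightarrow>\<^bsub>G\<^esub> w} = head G ` out_arcs G v"
    by (auto simp: arcs_ends_conv out_arcs_def)
  moreover have "inj_on (head G) (out_arcs G v)"
    by (auto intro!: inj_onI no_multi_arcs simp: out_arcs_def arc_to_ends_def)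
  ultimately show ?thesis
    by (simp add: out_degree_def card_image)
qed

text \<open>The maximum in \<open>clique_number\<close> and the minimum in \<open>chromatic_number\<close> are attained.\<close>

lemma (in fin_digraph) clique_number_attained:
  "\<exists>K. clique_in G K \<and> card K = clique_number G"
proof -
  have "{K. clique_in G K} \<subseteq> Pow (verts G)"
    by (auto simp: clique_in_def)
  then have "finite {K. clique_in G K}"
    by (rule finite_subset) simp
  moreover have "{} \<in> {K. clique_in G K}"
    by (simp add: clique_in_def)
  ultimately have "clique_number G \<in> card ` {K. clique_in G K}"
    unfolding clique_number_def by (intro Max_in) auto
  then show ?thesis by auto
qed

lemma (in digraph) chromatic_number_attained:
  "\<exists>c. proper_coloring G (chromatic_number G) c"
proof -
  obtain c where c: "inj_on c (verts G)" "c ` verts G = {..<card (verts G)}"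
    using ex_bij_betw_finite_nat[OF finite_verts]
    by (auto simp: bij_betw_def atLeast0LessThan)
  have "proper_coloring G (card (verts G)) c"
    unfolding proper_coloring_def
  proof (intro conjI ballI allI impI)
    show "c v < card (verts G)" if "v \<in> verts G" for v
      using c(2) that by auto
    show "c u \<noteq> c v" if "u \<rightarrow>\<^bsub>G\<^esub> v" for u v
      using that c(1) adj_not_same adj_in_verts by (metis inj_onD)
  qed
  then have "\<exists>k c. proper_coloring G k c" by blast
  then show ?thesis
    unfolding chromatic_number_def by (rule LeastI_ex)
qed

end

theory Submission
  imports Defs "HOL-Library.Disjoint_Sets"
begin

text \<open>
  The proof is by induction on the number of vertices. Write \<open>\<omega>\<close> for the clique number
  and \<open>\<Delta>\<close> for the maximum degree of the graph.

  If \<open>4\<omega> \<le> 3(\<Delta> + 1)\<close>, then \<open>7\<omega>/6 \<le> (\<omega> + \<Delta> + 1)/2\<close>, so the hypothesis for the whole graph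
  already is the claim.

  If \<open>4\<omega> \<ge> 3(\<Delta> + 1)\<close>, some stable set meets every maximum clique (a theorem of Rabern,
  \<open>stable_set_hitting_maximum_cliques\<close>). Enlarge it to a maximal stable set. Deleting it lowers
  \<open>\<omega>\<close> by at least one, because every maximum clique is hit, and lowers \<open>\<Delta>\<close> by at least one,
  because every remaining vertex has a neighbour in the deleted set. So, unless no vertex is left,
  the bound drops by at least one, while the deleted set costs only one colour.

  For the stable set, consider the maximum cliques that meet a given one. By Hajnal's inequality
  \<open>|\<Inter>F| + |\<Union>F| \<ge> 2\<omega>\<close> for families \<open>F\<close> of maximum cliques (\<open>hajnal\<close>), intersecting maximum cliques overlap in more than half of
  their vertices, enough to make intersecting an equivalence relation whose classes all have a
  nonempty common intersection (\<open>star_common_vertex\<close>), of size at least \<open>2\<omega> - (\<Delta> + 1)\<close>. A vertex of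
  such a core has at most \<open>\<Delta> + 1 - \<omega>\<close> neighbours in the other cores, which is at most half
  the size of a core. By Haxell's theorem (\<open>haxell\<close>) there is a stable set that has a vertex
  in every core, and it meets every maximum clique.
\<close>

section \<open>Independent transversals\<close>

text \<open>
  A choice of one element from each part \<open>V i\<close>, \<open>i \<in> I\<close>, such that the elements
  chosen for different parts are not related by \<open>E\<close>. Pairs of \<open>E\<close> inside a part do not matter.
\<close>

definition independent_transversal ::
    "('a \<times> 'a) set \<Rightarrow> ('i \<Rightarrow> 'a set) \<Rightarrow> 'i set \<Rightarrow> ('i \<Rightarrow> 'a) \<Rightarrow> bool" where
  "independent_transversal E V I f \<longleftrightarrow>
     (\<forall>i\<in>I. f i \<in> V i) \<and> (\<forall>i\<in>I. \<forall>j\<in>I. i \<noteq> j \<longrightarrow> (f i, f j) \<notin> E)"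

lemma independent_transversalD:
  assumes "independent_transversal E V I f"
  shows "i \<in> I \<Longrightarrow> f i \<in> V i"
    and "i \<in> I \<Longrightarrow> j \<in> I \<Longrightarrow> i \<noteq> j \<Longrightarrow> (f i, f j) \<notin> E"
  using assms by (auto simp: independent_transversal_def)

lemma independent_transversal_fun_upd:
  assumes f: "independent_transversal E V (I - {a}) f" and x: "x \<in> V a"
    and "\<And>i. i \<in> I - {a} \<Longrightarrow> (x, f i) \<notin> E" "\<And>i. i \<in> I - {a} \<Longrightarrow> (f i, x) \<notin> E"
  shows "independent_transversal E V I (f(a := x))"
  unfolding independent_transversal_def
proof (intro conjI ballI impI)
  show "(f(a := x)) i \<in> V i" if "i \<in> I" for i
    using independent_transversalD(1)[OF f, of i] that x by simp
  show "((f(a := x)) i, (f(a := x)) j) \<notin> E" if "i \<in> I" "j \<in> I" "i \<noteq> j" for i j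
    using independent_transversalD(2)[OF f, of i j] that assms(3,4) by auto
qed

text \<open>
  The combinatorial core of Haxell's theorem: if all parts but \<open>V a\<close> have a transversal and all
  parts together have none, then some subfamily \<open>S\<close> of parts is dominated by few vertices.
  Deleting edges as long as no transversal arises leaves an edge \<open>wt\<close>, with \<open>w\<close> in \<open>V a\<close> and
  \<open>t\<close> in some other part \<open>V b\<close>, whose removal creates a transversal through \<open>w\<close> and \<open>t\<close>. Remove all
  neighbours of \<open>w\<close> and \<open>t\<close> and merge \<open>V a\<close> with \<open>V b\<close>. If the merged part is empty, \<open>w\<close> and \<open>t\<close>
  dominate \<open>V a\<close> and \<open>V b\<close>. Otherwise a transversal of the new, smaller
  family would extend by \<open>w\<close> or \<open>t\<close> to one of the old family, so the induction hypothesis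
  applies, and adding \<open>w\<close> and \<open>t\<close> to the dominating set accounts for the removed vertices.
\<close>

lemma dominated_subfamily:
  assumes "finite I" "finite E" "sym E" "disjoint_family_on V I"
    and "a \<in> I" "V a \<noteq> {}"
    and "independent_transversal E V (I - {a}) f"
    and "\<nexists>g. independent_transversal E V I g"
  shows "\<exists>S Z. a \<in> S \<and> S \<subseteq> I \<and> finite Z \<and> Z \<subseteq> (\<Union>i\<in>S. V i) \<and>
           card Z \<le> 2 * (card S - 1) \<and> (\<forall>v\<in>(\<Union>i\<in>S. V i). \<exists>z\<in>Z. (z, v) \<in> E)"
  using assms
proof (induction "card I" arbitrary: I V E f rule: less_induct)
  case less
  define P where "P = {E'. E' \<subseteq> E \<and> sym E' \<and> (\<nexists>g. independent_transversal E' V I g)}"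
  have "finite P"
    unfolding P_def by (rule finite_subset[of _ "Pow E"]) (auto simp: less.prems(2))
  moreover have "E \<in> P"
    using less.prems by (simp add: P_def)
  ultimately obtain E0 where E0: "E0 \<in> P" and min: "\<And>E'. E' \<in> P \<Longrightarrow> E' \<subseteq> E0 \<Longrightarrow> E0 = E'"
    using finite_has_minimal[of P] by blast
  have sub: "E0 \<subseteq> E" and sym: "\<And>u v. (u, v) \<in> E0 \<Longrightarrow> (v, u) \<in> E0"
    and noIT: "\<And>g. \<not> independent_transversal E0 V I g"
    using E0 by (auto simp: P_def dest: symD)
  have disj: "i = j" if "x \<in> V i" "x \<in> V j" "i \<in> I" "j \<in> I" for x i j
    using less.prems(4) that by (auto simp: disjoint_family_on_def)
  obtain w where w: "w \<in> V a"
    using less.prems(6) by blast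
  have fE0: "independent_transversal E0 V (I - {a}) f"
    using less.prems(7) sub unfolding independent_transversal_def by blast
  have "\<exists>b\<in>I - {a}. (w, f b) \<in> E0"
  proof (rule ccontr)
    assume "\<not> ?thesis"
    then have "independent_transversal E0 V I (f(a := w))"
      using independent_transversal_fun_upd[OF fE0 w] sym by blast
    then show False using noIT by blast
  qed
  then obtain b where b: "b \<in> I" "b \<noteq> a" "(w, f b) \<in> E0" by blast
  define t where "t = f b"
  have t: "t \<in> V b" "(w, t) \<in> E0"
    using independent_transversalD(1)[OF fE0, of b] b by (auto simp: t_def)
  define E1 where "E1 = E0 - {(w, t), (t, w)}"
  have "E1 \<noteq> E0" "E1 \<subseteq> E0" "sym E1"
    using t sym by (auto simp: E1_def intro!: symI)
  then have "E1 \<notin> P"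
    using min by blast
  then obtain h where "independent_transversal E1 V I h"
    using \<open>sym E1\<close> \<open>E1 \<subseteq> E0\<close> sub unfolding P_def by blast
  note h = independent_transversalD[OF this]
  obtain i j where ij: "i \<in> I" "j \<in> I" "i \<noteq> j" "(h i, h j) \<in> E0"
    using noIT[of h] h(1) by (auto simp: independent_transversal_def)
  then have "(h i, h j) \<in> {(w, t), (t, w)}"
    using h(2)[of i j] by (auto simp: E1_def)
  then have "\<exists>i\<in>I. h i = w" "\<exists>i\<in>I. h i = t"
    using ij by auto
  then have hab: "h a = w" "h b = t"
    using h(1) disj[of w _ a] disj[of t _ b] w t(1) b(1) less.prems(5) by blast+
  define N where "N = {v. (w, v) \<in> E0 \<or> (t, v) \<in> E0}"
  define V' where "V' i = (if i = a then V a \<union> V b else V i) - N" for i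
  let ?I = "I - {b}"
  show ?case
  proof (cases "V' a = {}")
    case True
    then have "V a \<union> V b \<subseteq> N" by (auto simp: V'_def)
    moreover have "card {w, t} \<le> 2 * (card {a, b} - 1)"
      using b by (auto simp: card_insert_if)
    ultimately show ?thesis
      using b w t sub less.prems(5)
      by (intro exI[of _ "{a, b}"] exI[of _ "{w, t}"]) (auto simp: N_def)
  next
    case False
    have "h i \<notin> N" if "i \<in> I" "i \<noteq> a" "i \<noteq> b" for i
    proof
      assume "h i \<in> N"
      moreover have "(w, h i) \<notin> E1" "(t, h i) \<notin> E1"
        using h(2)[of a i] h(2)[of b i] hab that b less.prems(5) by auto
      ultimately have "h i = w \<or> h i = t"
        by (auto simp: N_def E1_def)
      then show False
        using h(1)[OF that(1)] that disj[of w i a] disj[of t i b] w t(1) b(1) less.prems(5)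
        by blast
    qed
    note hN = this
    have IT: "independent_transversal E0 V' (?I - {a}) h"
      unfolding independent_transversal_def
    proof (intro conjI ballI impI)
      show "h i \<in> V' i" if "i \<in> ?I - {a}" for i
        using that h(1)[of i] hN[of i] by (simp add: V'_def)
      show "(h i, h j) \<notin> E0" if "i \<in> ?I - {a}" "j \<in> ?I - {a}" "i \<noteq> j" for i j
        using that h(2)[of i j] hN[of i] hN[of j] t(2) sym by (auto simp: E1_def N_def)
    qed
    have noIT': "\<not> independent_transversal E0 V' ?I k" for k
    proof
      assume "independent_transversal E0 V' ?I k"
      note k = independent_transversalD[OF this]
      have kV: "k i \<in> V i" if "i \<in> I" "i \<noteq> a" "i \<noteq> b" for i
        using k(1)[of i] that by (auto simp: V'_def)
      have kN: "(w, k i) \<notin> E0" "(t, k i) \<notin> E0" "(k i, w) \<notin> E0" "(k i, t) \<notin> E0"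
        if "i \<in> I" "i \<noteq> b" for i
        using k(1)[of i] that sym[of "k i"] by (auto simp: V'_def N_def split: if_splits)
      have kIT: "independent_transversal E0 V (I - {a} - {b}) k"
        using kV k(2) by (simp add: independent_transversal_def)
      have kE: "(k i, k j) \<notin> E0" if "i \<in> I - {b}" "j \<in> I - {b}" "i \<noteq> j" for i j
        using k(2) that by simp
      have "k a \<in> V a \<or> k a \<in> V b"
        using k(1)[of a] less.prems(5) b by (auto simp: V'_def)
      then show False
      proof
        assume "k a \<in> V a"
        then have "independent_transversal E0 V (I - {b}) k"
          using kV kE by (auto simp: independent_transversal_def)
        then show False
          using independent_transversal_fun_upd[of E0 V I b k t] t(1) kN noIT by blast
      next
        assume "k a \<in> V b"
        moreover have "(k a, k i) \<notin> E0" "(k i, k a) \<notin> E0" if "i \<in> I - {a} - {b}" for i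
          using kE[of a i] kE[of i a] that less.prems(5) b by auto
        ultimately have "independent_transversal E0 V (I - {a}) (k(b := k a))"
          using kIT by (intro independent_transversal_fun_upd) auto
        moreover have "(w, (k(b := k a)) i) \<notin> E0" "((k(b := k a)) i, w) \<notin> E0"
          if "i \<in> I - {a}" for i
          using that kN[of i] kN[of a] b less.prems(5) by auto
        ultimately show False
          using independent_transversal_fun_upd[of E0 V I a "k(b := k a)" w] w noIT by blast
      qed
    qed
    have "disjoint_family_on V' ?I"
      unfolding disjoint_family_on_def
    proof (intro ballI impI)
      fix m n assume "m \<in> ?I" "n \<in> ?I" "m \<noteq> n"
      then show "V' m \<inter> V' n = {}"
        using disj[of _ m n] disj[of _ b n] disj[of _ b m] b less.prems(5)
        by (auto simp: V'_def)
    qed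
    moreover have "card ?I < card I"
      by (rule card_Diff1_less[OF less.prems(1) b(1)])
    moreover have "finite E0" "sym E0"
      using sub less.prems(2) E0 by (auto simp: P_def intro: finite_subset)
    ultimately obtain S Z where S: "a \<in> S" "S \<subseteq> ?I" "finite Z" "Z \<subseteq> (\<Union>i\<in>S. V' i)"
        "card Z \<le> 2 * (card S - 1)" "\<forall>v\<in>(\<Union>i\<in>S. V' i). \<exists>z\<in>Z. (z, v) \<in> E0"
      using less.hyps[of ?I E0 V' h] False IT noIT' less.prems(1,5) b by auto
    let ?S = "insert b S" and ?Z = "Z \<union> {w, t}"
    have finS: "finite S"
      using S(2) less.prems(1) by (auto intro: finite_subset)
    then have "card S > 0"
      using S(1) by (auto simp: card_gt_0_iff)
    moreover have "card ?S = card S + 1"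
      using S(2) finS by (auto simp: card_insert_if)
    moreover have "card ?Z \<le> card Z + 2"
      using card_Un_le[of Z "{w, t}"] by (auto simp: card_insert_if split: if_splits)
    ultimately have "card ?Z \<le> 2 * (card ?S - 1)"
      using S(5) by simp
    moreover have "?Z \<subseteq> (\<Union>i\<in>?S. V i)"
      using S(1,4) w t by (auto simp: V'_def split: if_splits)
    moreover have "\<exists>z\<in>?Z. (z, v) \<in> E" if "v \<in> V i" "i \<in> ?S" for v i
    proof (cases "v \<in> N")
      case True
      then show ?thesis using sub by (auto simp: N_def)
    next
      case vN: False
      have "v \<in> (\<Union>i\<in>S. V' i)"
        using that vN S(1) by (cases "i = b") (auto simp: V'_def)
      then show ?thesis using S(6) sub by blast
    qed
    ultimately show ?thesis
      using S(1,2,3) b by (intro exI[of _ ?S] exI[of _ ?Z]) auto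
  qed
qed

text \<open>
  Haxell's theorem: nonempty parts of size at least twice the maximum degree have an independent
  transversal. Otherwise some \<open>S\<close> parts, with at least \<open>2d|S|\<close> vertices in total, would be
  dominated by \<open>2(|S| - 1)\<close> vertices, each of which dominates at most \<open>d\<close>.
\<close>

theorem haxell:
  assumes "finite I" "finite E" "sym E" "disjoint_family_on V I"
    and fin: "\<And>i. i \<in> I \<Longrightarrow> finite (V i)"
    and ne: "\<And>i. i \<in> I \<Longrightarrow> V i \<noteq> {}"
    and size: "\<And>i. i \<in> I \<Longrightarrow> 2 * d \<le> card (V i)"
    and deg: "\<And>i v. i \<in> I \<Longrightarrow> v \<in> V i \<Longrightarrow> card {u \<in> (\<Union>j\<in>I. V j). (v, u) \<in> E} \<le> d"
  shows "\<exists>f. independent_transversal E V I f"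
proof -
  have "\<exists>f. independent_transversal E V J f" if "finite J" "J \<subseteq> I" for J
    using that
  proof (induction J rule: finite_induct)
    case empty
    show ?case by (simp add: independent_transversal_def)
  next
    case (insert a J)
    show ?case
    proof (rule ccontr)
      assume noIT: "\<nexists>f. independent_transversal E V (insert a J) f"
      obtain f where f: "independent_transversal E V (insert a J - {a}) f"
        using insert by auto
      obtain S Z where S: "a \<in> S" "S \<subseteq> insert a J" "finite Z" "Z \<subseteq> (\<Union>i\<in>S. V i)"
        "card Z \<le> 2 * (card S - 1)" "\<forall>v\<in>(\<Union>i\<in>S. V i). \<exists>z\<in>Z. (z, v) \<in> E"
        using dominated_subfamily[of "insert a J" E V a f] assms(2,3) f noIT ne[of a]
          insert.hyps insert.prems disjoint_family_on_mono[OF insert.prems assms(4)] by auto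
      have SI: "S \<subseteq> I" and finS: "finite S"
        using S(2) insert.prems insert.hyps by (auto intro: finite_subset)
      let ?U = "\<Union>i\<in>S. V i"
      let ?N = "\<lambda>z. {u \<in> (\<Union>j\<in>I. V j). (z, u) \<in> E}"
      have finU: "finite ?U" and finN: "\<And>z. finite (?N z)"
        using SI finS fin assms(1) by auto
      have cardS: "card S > 0"
        using S(1) finS by (auto simp: card_gt_0_iff)
      have "card ?U \<le> card (\<Union>z\<in>Z. ?N z)"
        using S(3,6) SI finN by (intro card_mono) fastforce+
      also have "\<dots> \<le> (\<Sum>z\<in>Z. card (?N z))"
        by (rule card_UN_le[OF S(3)])
      also have "\<dots> \<le> card Z * d"
        using sum_bounded_above[of Z "\<lambda>z. card (?N z)" d] S(4) SI deg by fastforce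
      also have "\<dots> \<le> 2 * (card S - 1) * d"
        using S(5) by (rule mult_right_mono) simp
      finally have le: "card ?U \<le> 2 * (card S - 1) * d" .
      have "card ?U = (\<Sum>i\<in>S. card (V i))"
        using assms(4) SI fin finS
        by (intro card_UN_disjoint) (auto simp: disjoint_family_on_def)
      also have "\<dots> \<ge> card S * (2 * d)"
        using sum_bounded_below[of S "2 * d" "\<lambda>i. card (V i)"] SI size by fastforce
      finally have "card S * (2 * d) \<le> 2 * (card S - 1) * d"
        using le by linarith
      moreover have "card ?U > 0"
        using S(1) SI ne[of a] finU by (auto simp: card_gt_0_iff)
      ultimately show False
        using le cardS by (cases "d = 0") (auto simp: algebra_simps)
    qed
  qed
  then show ?thesis using assms(1) by blast
qed

section \<open>Maximum cliques\<close>

text \<open>Cliques of maximum size, as opposed to inclusion-maximal ones.\<close>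

definition maximum_cliques :: "('a, 'b) pre_digraph \<Rightarrow> 'a set set" where
  "maximum_cliques G = {K. clique_in G K \<and> card K = clique_number G}"

text \<open>Sets of pairwise nonadjacent vertices.\<close>

definition stable_in :: "('a, 'b) pre_digraph \<Rightarrow> 'a set \<Rightarrow> bool" where
  "stable_in G S \<longleftrightarrow> S \<subseteq> verts G \<and> (\<forall>u\<in>S. \<forall>v\<in>S. \<not> u \<rightarrow>\<^bsub>G\<^esub> v)"

context graph
begin

lemma finite_cliques: "finite {K. clique_in G K}"
  by (rule finite_subset[of _ "Pow (verts G)"]) (auto simp: clique_in_def)

lemma clique_finite: "clique_in G K \<Longrightarrow> finite K"
  by (auto simp: clique_in_def intro: finite_subset)

lemma clique_card_le: "clique_in G K \<Longrightarrow> card K \<le> clique_number G"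
  unfolding clique_number_def using finite_cliques by (intro Max_ge) auto

lemma finite_maximum_cliques: "finite (maximum_cliques G)"
  using finite_cliques by (rule rev_finite_subset) (auto simp: maximum_cliques_def)

lemma finite_neighbours: "finite {w. v \<rightarrow> w}"
  by (rule finite_subset[OF _ finite_verts]) (auto dest: adj_in_verts)

lemma card_neighbours_le:
  assumes "v \<in> verts G"
  shows "card {w. v \<rightarrow> w} \<le> max_degree G"
  unfolding max_degree_def out_degree_eq_card_neighbours[symmetric]
  using assms by (intro Max_ge) auto

lemma card_Union_cliques_le:
  assumes "\<And>Q. Q \<in> F \<Longrightarrow> clique_in G Q" "v \<in> \<Inter>F" "F \<noteq> {}"
  shows "card (\<Union>F) \<le> max_degree G + 1"
proof -
  have "v \<in> verts G"
    using assms by (auto simp: clique_in_def)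
  have "\<Union>F \<subseteq> insert v {w. v \<rightarrow> w}"
    using assms by (fastforce simp: clique_in_def)
  then have "card (\<Union>F) \<le> card (insert v {w. v \<rightarrow> w})"
    using finite_neighbours by (intro card_mono) auto
  also have "\<dots> \<le> card {w. v \<rightarrow> w} + 1"
    by (simp add: card_insert_le_m1 card_insert_if finite_neighbours)
  finally show ?thesis
    using card_neighbours_le[OF \<open>v \<in> verts G\<close>] by simp
qed

text \<open>
  Hajnal's inequality. Adding a clique \<open>Q\<close> to the family \<open>F\<close> shrinks \<open>\<Inter>F\<close> by no more than it
  enlarges \<open>\<Union>F\<close>, because \<open>(Q \<inter> \<Union>F) \<union> \<Inter>F\<close> is a clique and so has at most \<open>|Q|\<close> vertices.
\<close>

lemma hajnal:
  assumes "finite F" "F \<noteq> {}" "F \<subseteq> maximum_cliques G"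
  shows "2 * clique_number G \<le> card (\<Inter>F) + card (\<Union>F)"
  using assms
proof (induction F rule: finite_ne_induct)
  case (singleton Q)
  then show ?case by (auto simp: maximum_cliques_def)
next
  case (insert Q F)
  let ?A = "\<Inter>F" and ?B = "\<Union>F"
  have cl: "clique_in G R" if "R \<in> insert Q F" for R
    using insert.prems that by (auto simp: maximum_cliques_def)
  have cQ: "card Q = clique_number G"
    using insert.prems by (auto simp: maximum_cliques_def)
  have "?A \<subseteq> ?B" using insert.hyps by auto
  have fin: "finite ?B" "finite Q" "finite ?A"
    using cl insert.hyps clique_finite finite_subset[OF \<open>?A \<subseteq> ?B\<close>] by auto
  \<comment> \<open>Every vertex of \<open>\<Inter>F\<close> is adjacent to every other vertex of \<open>\<Union>F\<close>.\<close>
  have "clique_in G ((Q \<inter> ?B) \<union> ?A)"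
    unfolding clique_in_def
  proof (intro conjI ballI impI)
    show "Q \<inter> ?B \<union> ?A \<subseteq> verts G"
      using cl insert.hyps by (auto simp: clique_in_def)
    have AB: "u \<rightarrow> v" if "u \<in> ?A" "v \<in> ?B" "u \<noteq> v" for u v
      using that cl unfolding clique_in_def by blast
    fix u v assume uv: "u \<in> Q \<inter> ?B \<union> ?A" "v \<in> Q \<inter> ?B \<union> ?A" "u \<noteq> v"
    show "u \<rightarrow> v"
    proof (cases "u \<in> Q \<and> v \<in> Q")
      case True
      then show ?thesis using cl[of Q] uv by (auto simp: clique_in_def)
    next
      case False
      then have "(u \<in> ?A \<and> v \<in> ?B) \<or> (v \<in> ?A \<and> u \<in> ?B)"
        using uv \<open>?A \<subseteq> ?B\<close> by blast
      then show ?thesis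
        using AB uv(3) graph_symmetric by metis
    qed
  qed
  then have "card ((Q \<inter> ?B) \<union> ?A) \<le> clique_number G"
    by (rule clique_card_le)
  moreover have "card (Q \<inter> ?B) + card ?A = card ((Q \<inter> ?B) \<union> ?A) + card (Q \<inter> ?A)"
    using card_Un_Int[of "Q \<inter> ?B" ?A] fin \<open>?A \<subseteq> ?B\<close> by (simp add: inf.absorb2 Int_assoc)
  moreover have "card Q + card ?B = card (Q \<union> ?B) + card (Q \<inter> ?B)"
    using card_Un_Int[of Q ?B] fin by simp
  moreover have "2 * clique_number G \<le> card ?A + card ?B"
    using insert by auto
  ultimately show ?case
    using cQ by (simp add: Int_commute)
qed

lemma card_Inter_maximum_cliques_ge:
  assumes "F \<subseteq> maximum_cliques G" "F \<noteq> {}" "\<Inter>F \<noteq> {}"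
  shows "2 * clique_number G \<le> card (\<Inter>F) + (max_degree G + 1)"
proof -
  obtain v where v: "v \<in> \<Inter>F" using assms(3) by blast
  have "card (\<Union>F) \<le> max_degree G + 1"
    using assms by (intro card_Union_cliques_le[OF _ v]) (auto simp: maximum_cliques_def)
  moreover have "finite F"
    using assms(1) finite_maximum_cliques by (rule finite_subset)
  ultimately show ?thesis
    using hajnal[of F] assms by simp
qed

text \<open>
  The common intersection of some of the cliques and the intersection of \<open>Q\<close> with a further one
  each fill more than half of \<open>Q\<close>, so they meet.
\<close>

lemma star_common_vertex:
  assumes big: "3 * (max_degree G + 1) \<le> 4 * clique_number G"
    and Q: "Q \<in> maximum_cliques G"
    and F: "F \<subseteq> maximum_cliques G" "\<And>R. R \<in> F \<Longrightarrow> Q \<inter> R \<noteq> {}"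
  shows "\<Inter>(insert Q F) \<noteq> {}"
proof -
  have "finite F"
    using F(1) finite_maximum_cliques by (rule finite_subset)
  then show ?thesis using F
  proof (induction F rule: finite_induct)
    case empty
    then show ?case using Q big by (auto simp: maximum_cliques_def)
  next
    case (insert R F)
    have finQ: "finite Q" and cQ: "card Q = clique_number G"
      using Q clique_finite by (auto simp: maximum_cliques_def)
    let ?A = "\<Inter>(insert Q F)"
    have "2 * clique_number G \<le> card ?A + (max_degree G + 1)"
      using insert Q by (intro card_Inter_maximum_cliques_ge) auto
    moreover have "2 * clique_number G \<le> card (\<Inter>{Q, R}) + (max_degree G + 1)"
      using insert.prems(1) insert.prems(2)[of R] Q
      by (intro card_Inter_maximum_cliques_ge) auto
    moreover have "card (?A \<union> (Q \<inter> R)) \<le> card Q"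
      using finQ by (intro card_mono) auto
    moreover have "card ?A + card (Q \<inter> R) = card (?A \<union> (Q \<inter> R)) + card (?A \<inter> (Q \<inter> R))"
      using finQ by (intro card_Un_Int) auto
    ultimately have "card (?A \<inter> (Q \<inter> R)) > 0"
      using big cQ by simp
    then have "?A \<inter> (Q \<inter> R) \<noteq> {}" by force
    then show ?case by auto
  qed
qed

text \<open>
  Rabern's theorem. Here \<open>C Q\<close> is the class of the maximum cliques that meet \<open>Q\<close>, and the core
  of a class is its intersection.
\<close>

theorem stable_set_hitting_maximum_cliques:
  assumes big: "3 * (max_degree G + 1) \<le> 4 * clique_number G"
  shows "\<exists>S. stable_in G S \<and> (\<forall>Q\<in>maximum_cliques G. Q \<inter> S \<noteq> {})"
proof -
  let ?M = "maximum_cliques G" and ?w = "clique_number G" and ?D = "max_degree G"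
  define C where "C Q = {R \<in> ?M. Q \<inter> R \<noteq> {}}" for Q
  define I where "I = C ` ?M"
  have selfC: "Q \<in> C Q" if "Q \<in> ?M" for Q
    using that big by (auto simp: C_def maximum_cliques_def)
  have trans: "P \<inter> R \<noteq> {}"
    if "P \<in> ?M" "Q \<in> ?M" "R \<in> ?M" "Q \<inter> P \<noteq> {}" "Q \<inter> R \<noteq> {}" for P Q R
    using star_common_vertex[OF big, of Q "{P, R}"] that by auto
  have C_eq: "C Q = C R" if "Q \<in> ?M" "R \<in> ?M" "Q \<inter> R \<noteq> {}" for Q R
  proof -
    have "C Q \<subseteq> C R" if "Q \<in> ?M" "R \<in> ?M" "Q \<inter> R \<noteq> {}" for Q R
      using trans[of R Q] that by (auto simp: C_def)
    then show ?thesis using that by (metis Int_commute subset_antisym)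
  qed
  have core_sub: "\<Inter>(C Q) \<subseteq> Q" if "Q \<in> ?M" for Q
    using selfC[OF that] by auto
  have same: "i = C Q" if "i \<in> I" "Q \<in> ?M" "v \<in> \<Inter>i" "v \<in> Q" for i Q v
  proof -
    obtain R where R: "R \<in> ?M" "i = C R" using \<open>i \<in> I\<close> by (auto simp: I_def)
    then have "v \<in> R" using core_sub that by blast
    then show ?thesis using C_eq[of R Q] R that by auto
  qed
  have core_ne: "\<Inter>i \<noteq> {}" and core_card: "2 * ?w \<le> card (\<Inter>i) + (?D + 1)"
    and core_fin: "finite (\<Inter>i)" and core_verts: "\<Inter>i \<subseteq> verts G" if i: "i \<in> I" for i
  proof -
    obtain Q where Q: "Q \<in> ?M" "i = C Q" using i by (auto simp: I_def)
    have "\<Inter>(insert Q (C Q)) \<noteq> {}"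
      using Q by (intro star_common_vertex big) (auto simp: C_def)
    then show *: "\<Inter>i \<noteq> {}"
      using selfC[OF Q(1)] Q(2) by (simp add: insert_absorb)
    show "2 * ?w \<le> card (\<Inter>i) + (?D + 1)"
      using * selfC[OF Q(1)] Q(2) by (intro card_Inter_maximum_cliques_ge) (auto simp: C_def)
    have "Q \<subseteq> verts G"
      using Q(1) by (auto simp: maximum_cliques_def clique_in_def)
    then show "\<Inter>i \<subseteq> verts G"
      using core_sub[OF Q(1)] Q(2) by blast
    then show "finite (\<Inter>i)" by (rule finite_subset) simp
  qed
  \<comment> \<open>Adjacent pairs inside one core do not matter for a transversal of the cores.\<close>
  define E where "E = {(u, v). u \<rightarrow> v \<and> (\<forall>i\<in>I. \<not> (u \<in> \<Inter>i \<and> v \<in> \<Inter>i))}"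
  have "\<exists>f. independent_transversal E Inter I f"
  proof (rule haxell[where d = "?D + 1 - ?w"])
    show "finite I" using finite_maximum_cliques by (simp add: I_def)
    show "finite E"
      by (rule finite_subset[of _ "verts G \<times> verts G"]) (auto simp: E_def dest: adj_in_verts)
    show "sym E" by (auto simp: E_def intro!: symI dest: graph_symmetric)
    show "disjoint_family_on Inter I"
      unfolding disjoint_family_on_def
    proof (intro ballI impI)
      fix i j assume ij: "i \<in> I" "j \<in> I" "i \<noteq> j"
      obtain Q where Q: "Q \<in> ?M" "j = C Q" using ij by (auto simp: I_def)
      show "\<Inter>i \<inter> \<Inter>j = {}"
      proof (rule ccontr)
        assume "\<Inter>i \<inter> \<Inter>j \<noteq> {}"
        then obtain v where "v \<in> \<Inter>i" "v \<in> \<Inter>j" by blast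
        then show False using same[OF ij(1) Q(1)] core_sub Q ij(3) by blast
      qed
    qed
    fix i assume i: "i \<in> I"
    show "finite (\<Inter>i)" "\<Inter>i \<noteq> {}" using core_fin core_ne i by auto
    show "2 * (?D + 1 - ?w) \<le> card (\<Inter>i)"
      using core_card[OF i] big by simp
    fix v assume v: "v \<in> \<Inter>i"
    obtain Q where Q: "Q \<in> ?M" "i = C Q" using i by (auto simp: I_def)
    have vQ: "v \<in> Q" using core_sub Q v by blast
    have clQ: "clique_in G Q" "card Q = ?w" using Q by (auto simp: maximum_cliques_def)
    have sub: "Q - {v} \<subseteq> {w. v \<rightarrow> w}"
      using clQ vQ by (auto simp: clique_in_def)
    have "{u \<in> (\<Union>j\<in>I. \<Inter>j). (v, u) \<in> E} \<subseteq> {w. v \<rightarrow> w} - (Q - {v})"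
    proof
      fix u assume u: "u \<in> {u \<in> (\<Union>j\<in>I. \<Inter>j). (v, u) \<in> E}"
      then obtain j where j: "j \<in> I" "u \<in> \<Inter>j" by blast
      have "u \<notin> Q"
      proof
        assume "u \<in> Q"
        then have "j = i" using same[OF j(1) Q(1) j(2)] Q(2) by simp
        then show False using u v j i by (auto simp: E_def)
      qed
      then show "u \<in> {w. v \<rightarrow> w} - (Q - {v})" using u by (auto simp: E_def)
    qed
    then have "card {u \<in> (\<Union>j\<in>I. \<Inter>j). (v, u) \<in> E} \<le> card ({w. v \<rightarrow> w} - (Q - {v}))"
      using finite_neighbours by (intro card_mono) auto
    also have "\<dots> = card {w. v \<rightarrow> w} - card (Q - {v})"
      using sub clique_finite[OF clQ(1)] by (intro card_Diff_subset) auto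
    also have "\<dots> = card {w. v \<rightarrow> w} - (?w - 1)"
      using clQ vQ clique_finite by simp
    also have "\<dots> \<le> ?D + 1 - ?w"
      using card_neighbours_le[of v] clQ(1) vQ big by (auto simp: clique_in_def)
    finally show "card {u \<in> (\<Union>j\<in>I. \<Inter>j). (v, u) \<in> E} \<le> ?D + 1 - ?w" .
  qed
  then obtain f where "independent_transversal E Inter I f" ..
  note f = independent_transversalD[OF this]
  have "stable_in G (f ` I)"
    unfolding stable_in_def
  proof (intro conjI ballI notI)
    show "f ` I \<subseteq> verts G" using f(1) core_verts by blast
    fix u v assume "u \<in> f ` I" "v \<in> f ` I" and uv: "u \<rightarrow> v"
    then obtain i j where ij: "i \<in> I" "j \<in> I" "u = f i" "v = f j" by blast
    have "i \<noteq> j" using ij uv adj_not_same by auto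
    then obtain k where k: "k \<in> I" "f i \<in> \<Inter>k" "f j \<in> \<Inter>k"
      using f(2)[of i j] ij uv by (auto simp: E_def)
    obtain Q where Q: "Q \<in> ?M" "k = C Q" using k(1) by (auto simp: I_def)
    have "f i \<in> Q" "f j \<in> Q" using core_sub[OF Q(1)] Q(2) k by blast+
    then have "i = C Q" "j = C Q"
      using same[OF ij(1) Q(1) f(1)] same[OF ij(2) Q(1) f(1)] ij by auto
    then show False using \<open>i \<noteq> j\<close> by simp
  qed
  moreover have "Q \<inter> f ` I \<noteq> {}" if "Q \<in> ?M" for Q
  proof -
    have "C Q \<in> I" using that by (simp add: I_def)
    then have "f (C Q) \<in> Q" "f (C Q) \<in> f ` I"
      using f(1) core_sub[OF that] by blast+
    then show ?thesis by blast
  qed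
  ultimately show ?thesis by blast
qed

section \<open>Deleting a maximal stable set\<close>

lemma graph_induce_subgraph:
  assumes "T \<subseteq> verts G"
  shows "graph (G \<restriction> T)"
proof -
  have reverse: "\<exists>e'\<in>arcs G. tail G e = head G e' \<and> head G e = tail G e'" if "e \<in> arcs G" for e
    using sym_arcs that by (auto simp: symmetric_conv)
  show ?thesis
  proof unfold_locales
    show "finite (verts (G \<restriction> T))"
      using assms by (auto intro: finite_subset)
    show "symmetric (G \<restriction> T)"
      unfolding symmetric_conv
    proof
      fix e assume "e \<in> arcs (G \<restriction> T)"
      then show "\<exists>e2\<in>arcs (G \<restriction> T). tail (G \<restriction> T) e = head (G \<restriction> T) e2
          \<and> head (G \<restriction> T) e = tail (G \<restriction> T) e2"
        using reverse[of e] by force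
    qed
  qed (auto simp: no_loops arc_to_ends_def intro: no_multi_arcs)
qed

lemma adj_induce_subgraph:
  "u \<rightarrow>\<^bsub>G \<restriction> T\<^esub> v \<longleftrightarrow> u \<in> T \<and> v \<in> T \<and> u \<rightarrow> v"
  by (auto simp: arcs_ends_conv)

lemma maximal_stable_superset:
  assumes "stable_in G S"
  obtains S' where "stable_in G S'" "S \<subseteq> S'"
    "\<And>v. v \<in> verts G - S' \<Longrightarrow> \<exists>u\<in>S'. v \<rightarrow> u"
proof -
  have "finite {S. stable_in G S}"
    by (rule finite_subset[of _ "Pow (verts G)"]) (auto simp: stable_in_def)
  then obtain S' where S': "S \<subseteq> S'" "stable_in G S'"
    and max: "\<And>T. stable_in G T \<Longrightarrow> S' \<subseteq> T \<Longrightarrow> S' = T"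
    using finite_has_maximal2[of "{S. stable_in G S}" S] assms by auto
  have "\<exists>u\<in>S'. v \<rightarrow> u" if "v \<in> verts G - S'" for v
  proof (rule ccontr)
    assume "\<not> ?thesis"
    then have "stable_in G (insert v S')"
      using S'(2) that graph_symmetric adj_not_same unfolding stable_in_def by auto
    then show False using max[of "insert v S'"] that by blast
  qed
  then show ?thesis using that S' by blast
qed

lemma chromatic_number_delete_stable:
  assumes "stable_in G S"
  shows "chromatic_number G \<le> chromatic_number (G \<restriction> (verts G - S)) + 1"
proof -
  let ?H = "G \<restriction> (verts G - S)"
  interpret H: graph ?H by (rule graph_induce_subgraph) simp
  obtain c where c: "proper_coloring ?H (chromatic_number ?H) c"
    using H.chromatic_number_attained by blast
  have "proper_coloring G (chromatic_number ?H + 1)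
      (\<lambda>v. if v \<in> S then chromatic_number ?H else c v)"
    unfolding proper_coloring_def
  proof (intro conjI ballI allI impI)
    have lt: "c v < chromatic_number ?H" if "v \<in> verts G - S" for v
      using c that by (auto simp: proper_coloring_def)
    show "(if v \<in> S then chromatic_number ?H else c v) < chromatic_number ?H + 1"
      if "v \<in> verts G" for v
      using lt[of v] that by auto
    show "(if u \<in> S then chromatic_number ?H else c u) \<noteq>
          (if v \<in> S then chromatic_number ?H else c v)" if "u \<rightarrow> v" for u v
      using that lt[of u, THEN less_imp_neq] lt[of v, THEN less_imp_neq]
        adj_in_verts[OF that] assms c
      by (auto simp: stable_in_def proper_coloring_def adj_induce_subgraph)
  qed
  then show ?thesis
    unfolding chromatic_number_def[of G] by (intro Least_le) blast
qed

lemma clique_number_delete_hitting: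
  assumes "\<forall>Q\<in>maximum_cliques G. Q \<inter> S \<noteq> {}"
  shows "clique_number (G \<restriction> (verts G - S)) < clique_number G"
proof -
  let ?H = "G \<restriction> (verts G - S)"
  interpret H: graph ?H by (rule graph_induce_subgraph) simp
  obtain K where K: "clique_in ?H K" "card K = clique_number ?H"
    using H.clique_number_attained by blast
  have clK: "clique_in G K" and "K \<inter> S = {}"
    using K(1) by (auto simp: clique_in_def adj_induce_subgraph)
  then have "card K \<noteq> clique_number G"
    using assms by (auto simp: maximum_cliques_def)
  then show ?thesis using clique_card_le[OF clK] K(2) by simp
qed

lemma max_degree_delete_dominating:
  assumes "\<And>v. v \<in> verts G - S \<Longrightarrow> \<exists>u\<in>S. v \<rightarrow> u" "verts G - S \<noteq> {}"
  shows "max_degree (G \<restriction> (verts G - S)) < max_degree G"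
proof -
  let ?H = "G \<restriction> (verts G - S)"
  interpret H: graph ?H by (rule graph_induce_subgraph) simp
  have lt: "out_degree ?H v < max_degree G" if v: "v \<in> verts G - S" for v
  proof -
    obtain u where u: "u \<in> S" "v \<rightarrow> u" using assms(1)[OF v] by blast
    have "card {w. v \<rightarrow>\<^bsub>?H\<^esub> w} < card {w. v \<rightarrow> w}"
      using u finite_neighbours by (intro psubset_card_mono) (auto simp: adj_induce_subgraph)
    then show ?thesis
      using card_neighbours_le[of v] v by (simp add: H.out_degree_eq_card_neighbours)
  qed
  moreover have "max_degree G > 0"
    using lt assms(2) by fastforce
  ultimately show ?thesis
    unfolding max_degree_def[of ?H] by (subst Max_less_iff) auto
qed

end

section \<open>Reed's bound\<close>

lemma induced_subgraph_trans:
  assumes "induced_subgraph K H" "induced_subgraph H G"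
  shows "induced_subgraph K G"
  using assms by (auto simp: induced_subgraph_def subgraph_def compatible_def)

theorem theoremD:
  fixes G :: "('a, 'b) pre_digraph"
  assumes "graph G"
    and "\<And>H. induced_subgraph H G \<Longrightarrow>
      int (chromatic_number H) \<le>
        max \<lceil>(7 / 6 :: real) * real (clique_number H)\<rceil>
            \<lceil>(real (clique_number H) + real (max_degree H) + 1) / 2\<rceil>"
  shows "int (chromatic_number G) \<le>
    \<lceil>(real (clique_number G) + real (max_degree G) + 1) / 2\<rceil>"
  using assms
proof (induction "card (verts G)" arbitrary: G rule: less_induct)
  case less
  interpret G: graph G by (rule less.prems)
  let ?w = "clique_number G" and ?D = "max_degree G"
  show ?case
  proof (cases "3 * (?D + 1) \<le> 4 * ?w")
    case False
    then have "(7 / 6 :: real) * real ?w \<le> (real ?w + real ?D + 1) / 2"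
      by simp
    then have "\<lceil>(7 / 6 :: real) * real ?w\<rceil> \<le> \<lceil>(real ?w + real ?D + 1) / 2\<rceil>"
      by (rule ceiling_mono)
    then show ?thesis
      using less.prems(2)[OF G.induced_subgraph_refl] by simp
  next
    case True
    obtain S0 where S0: "stable_in G S0" "\<forall>Q\<in>maximum_cliques G. Q \<inter> S0 \<noteq> {}"
      using G.stable_set_hitting_maximum_cliques[OF True] by blast
    obtain S where S: "stable_in G S" "S0 \<subseteq> S"
      and dom: "\<And>v. v \<in> verts G - S \<Longrightarrow> \<exists>u\<in>S. v \<rightarrow>\<^bsub>G\<^esub> u"
      using G.maximal_stable_superset[OF S0(1)] by blast
    let ?H = "G \<restriction> (verts G - S)"
    have hit: "\<forall>Q\<in>maximum_cliques G. Q \<inter> S \<noteq> {}"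
      using S0(2) S(2) by blast
    have graphH: "graph ?H" by (rule G.graph_induce_subgraph) simp
    have indH: "induced_subgraph ?H G" by (rule G.induced_induce) simp
    have chi: "chromatic_number G \<le> chromatic_number ?H + 1"
      by (rule G.chromatic_number_delete_stable[OF S(1)])
    have omega: "clique_number ?H < ?w"
      by (rule G.clique_number_delete_hitting[OF hit])
    show ?thesis
    proof (cases "verts G - S = {}")
      case True
      have "proper_coloring ?H 0 (\<lambda>_. 0)"
        using True by (auto simp: proper_coloring_def G.adj_induce_subgraph)
      then have "chromatic_number ?H = 0"
        unfolding chromatic_number_def by (intro Least_eq_0) blast
      moreover have "1 \<le> \<lceil>(real ?w + real ?D + 1) / 2\<rceil>"
        by (simp add: le_ceiling_iff add_pos_nonneg)
      ultimately show ?thesis using chi by linarith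
    next
      case False
      obtain Q where "Q \<in> maximum_cliques G"
        using G.clique_number_attained by (auto simp: maximum_cliques_def)
      then have "S \<noteq> {}" using hit by auto
      moreover have "S \<subseteq> verts G" using S(1) by (simp add: stable_in_def)
      ultimately have "card (verts ?H) < card (verts G)"
        by (intro psubset_card_mono) auto
      moreover have "\<And>K. induced_subgraph K ?H \<Longrightarrow> induced_subgraph K G"
        using induced_subgraph_trans indH by blast
      ultimately have IH: "int (chromatic_number ?H) \<le>
          \<lceil>(real (clique_number ?H) + real (max_degree ?H) + 1) / 2\<rceil>"
        using less.hyps[OF _ graphH] less.prems(2) by blast
      have "max_degree ?H < ?D"
        by (rule G.max_degree_delete_dominating[OF dom False])
      then have "(real (clique_number ?H) + real (max_degree ?H) + 1) / 2
          \<le> (real ?w + real ?D + 1) / 2 - 1"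
        using omega by simp
      then have "\<lceil>(real (clique_number ?H) + real (max_degree ?H) + 1) / 2\<rceil>
          \<le> \<lceil>(real ?w + real ?D + 1) / 2 - 1\<rceil>"
        by (rule ceiling_mono)
      also have "\<dots> = \<lceil>(real ?w + real ?D + 1) / 2\<rceil> - 1"
        by (rule ceiling_diff_one)
      finally show ?thesis using IH chi by linarith
    qed
  qed
qed

end
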